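(* Let $C\subseteq\{Fa,Fu\}$. Then $\{\Gamma_i\Rightarrow\Delta_i\}_{i\in I}\vdash_{\mathbf{STL}(C,N,D)}\Gamma\Rightarrow\Delta$ iff $\{\Gamma_i\Rightarrow\Delta_i\}_{i\in I}\vDash_{\mathbf{T}(C)}\Gamma\Rightarrow\Delta$. The same holds with $\mathbf{STL}(C,N,D)$ replaced by $\mathbf{STL}(C,N,H)$ (over the language with $\supset$).
   Context: \textbf{Calculus.} Language $\{\wedge,\vee,\to,\top,\bot,\nabla\}$, plus $\supset$ for the $H$ version. Sequents are $\Gamma\Rightarrow\Delta$ with finite multisets and $|\Delta|\le1$; $\nabla\Gamma=\{\nabla\gamma\mid\gamma\in\Gamma\}$. $\mathbf{STL}$ rules (premises / conclusion): - Axioms: $A\Rightarrow A$; $\bot\Rightarrow$; $\Rightarrow\top$. - Weakening: $\Gamma\Rightarrow\Delta$ / $\Gamma,A\Rightarrow\Delta$; $\Gamma\Rightarrow$ / $\Gamma\Rightarrow A$. - Contraction: $\Gamma,A,A\Rightarrow\Delta$ / $\Gamma,A\Rightarrow\Delta$. - Cut: $\Gamma\Rightarrow A$, $\Pi,A\Rightarrow\Delta$ / $\Pi,\Gamma\Rightarrow\Delta$. - Conjunction: left rules for either conjunct; $\Gamma\Rightarrow A$, $\Gamma\Rightarrow B$ / $\Gamma\Rightarrow A\wedge B$. - Disjunction: $A\Rightarrow\Delta$, $B\Rightarrow\Delta$ / $A\vee B\Rightarrow\Delta$; right rules for either disjunct. - Modality: $A\Rightarrow B$ / $\nabla A\Rightarrow\nabla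 B$. - Left implication: $\Gamma\Rightarrow A$, $\Gamma,B\Rightarrow\Delta$ / $\Gamma,\nabla(A\to B)\Rightarrow\Delta$. - Right implication: $\nabla\Gamma,A\Rightarrow B$ / $\Gamma\Rightarrow A\to B$. Additional rules: - (N): $\Gamma\Rightarrow\Delta$ / $\nabla\Gamma\Rightarrow\nabla\Delta$. - (D): $\Gamma,A\Rightarrow\Delta$, $\Gamma,B\Rightarrow\Delta$ / $\Gamma,A\vee B\Rightarrow\Delta$. - (Fa): $\Gamma,A\Rightarrow B$ / $\Gamma\Rightarrow\nabla(A\to B)$. - (Fu): $\nabla\Gamma\Rightarrow A$, $\nabla\Gamma,B\Rightarrow\nabla\Delta$ / $\Gamma,A\to B\Rightarrow\Delta$. - (H): $\Gamma\Rightarrow A$, $\Gamma,B\Rightarrow\Delta$ / $\Gamma,A\supset B\Rightarrow\Delta$; $\Gamma,A\Rightarrow B$ / $\Gamma\Rightarrow A\supset B$. \textbf{Topological semantics.} A dynamic topological system is $(X,f)$ with $X$ a topological space and $f:X\to X$ continuous. It is faithful (Fa) if $f$ is a topological embedding and full (Fu) if $f$ is surjective. $\mathbf{T}(C)$ is the class of dynamic topological systems satisfying $C$. $f_*:\mathcal{O}(X)\to\mathcal{O}(X)$ is the right adjoint of $f^{-1}$ on open sets ($f^{-1}(W)\subseteq U$ iff $W\subseteq f_*(U)$). A topological model $(X,f,V)$ assigns open sets to formulas with: - $V(\top)=X$, $V(\bot)=\varnothing$; - $\wedge,\vee$ interpreted as $\cap,\cup$; - $V(\nabla A)=f^{-1}(V(A))$;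 - $V(A\supset B)=int(V(A)^c\cup V(B))$; - $V(A\to B)=f_*(int(V(A)^c\cup V(B)))$. It validates $\Gamma\Rightarrow\Delta$ if $\bigcap_{\gamma\in\Gamma}V(\gamma)\subseteq\bigcup_{\delta\in\Delta}V(\delta)$. $\mathcal{S}\vDash_{\mathbf{T}(C)}S$ means every topological model on a system in $\mathbf{T}(C)$ validating $\mathcal{S}$ validates $S$. *)

theory Defs
  imports "HOL-Analysis.Abstract_Topology" "HOL-Library.Multiset"
begin

datatype 'p fm =
    Atom 'p
  | Top (\<open>\<^bold>\<top>\<close>)
  | Bot (\<open>\<^bold>\<bottom>\<close>)
  | And "'p fm" "'p fm" (infixr \<open>\<^bold>\<and>\<close> 75)
  | Or "'p fm" "'p fm" (infixr \<open>\<^bold>\<or>\<close> 73)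
  | Imp "'p fm" "'p fm" (infixr \<open>\<^bold>\<rightarrow>\<close> 71)
  | Nabla "'p fm" (\<open>\<^bold>\<nabla> _\<close> [80] 80)
  | HImp "'p fm" "'p fm" (infixr \<open>\<^bold>\<supset>\<close> 71)

datatype 'p sequent =
  Seq (antecedent: "'p fm multiset") (succedent: "'p fm multiset") (infix \<open>\<Rrightarrow>\<close> 60)

datatype axiom_name = Fa | Fu | N | D | H

primrec supset_free :: "'p fm \<Rightarrow> bool" where
  "supset_free (Atom p) \<longleftrightarrow> True"
| "supset_free \<^bold>\<top> \<longleftrightarrow> True"
| "supset_free \<^bold>\<bottom> \<longleftrightarrow> True"
| "supset_free (A \<^bold>\<and> B) \<longleftrightarrow> supset_free A \<and> supset_free B"
| "supset_free (A \<^bold>\<or> B) \<longleftrightarrow> supset_free A \<and> supset_free B"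
| "supset_free (A \<^bold>\<rightarrow> B) \<longleftrightarrow> supset_free A \<and> supset_free B"
| "supset_free (\<^bold>\<nabla> A) \<longleftrightarrow> supset_free A"
| "supset_free (A \<^bold>\<supset> B) \<longleftrightarrow> False"

text \<open>The connective \<open>\<^bold>\<supset>\<close> belongs to the language exactly when the rules (H) are present.\<close>

definition language :: "axiom_name set \<Rightarrow> 'p fm set" where
  "language R = {A. H \<in> R \<or> supset_free A}"

definition sequents :: "axiom_name set \<Rightarrow> 'p sequent set" where
  "sequents R = {\<Gamma> \<Rrightarrow> \<Delta> |\<Gamma> \<Delta>.
     size \<Delta> \<le> 1 \<and> set_mset \<Gamma> \<subseteq> language R \<and> set_mset \<Delta> \<subseteq> language R}"

abbreviation Nablas :: "'p fm multiset \<Rightarrow> 'p fm multiset" where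
  "Nablas \<Gamma> \<equiv> image_mset Nabla \<Gamma>"

text \<open>\<open>stl_rule R Ps S\<close>: the sequent \<open>S\<close> is the conclusion of an instance, with premises \<open>Ps\<close>,
  of a rule of \<open>STL(R)\<close>. That all sequents lie in the language and have at most one formula in
  the succedent is imposed in \<open>derives\<close> below.\<close>

inductive stl_rule :: "axiom_name set \<Rightarrow> 'p sequent list \<Rightarrow> 'p sequent \<Rightarrow> bool"
  for R :: "axiom_name set" where
  identity: "stl_rule R [] ({#A#} \<Rrightarrow> {#A#})"
| bot_left: "stl_rule R [] ({#\<^bold>\<bottom>#} \<Rrightarrow> {#})"
| top_right: "stl_rule R [] ({#} \<Rrightarrow> {#\<^bold>\<top>#})"
| weak_left: "stl_rule R [\<Gamma> \<Rrightarrow> \<Delta>] (\<Gamma> + {#A#} \<Rrightarrow> \<Delta>)"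
| weak_right: "stl_rule R [\<Gamma> \<Rrightarrow> {#}] (\<Gamma> \<Rrightarrow> {#A#})"
| contr_left: "stl_rule R [\<Gamma> + {#A, A#} \<Rrightarrow> \<Delta>] (\<Gamma> + {#A#} \<Rrightarrow> \<Delta>)"
| cut: "stl_rule R [\<Gamma> \<Rrightarrow> {#A#}, \<Theta> + {#A#} \<Rrightarrow> \<Delta>] (\<Theta> + \<Gamma> \<Rrightarrow> \<Delta>)"
| and_left1: "stl_rule R [\<Gamma> + {#A#} \<Rrightarrow> \<Delta>] (\<Gamma> + {#A \<^bold>\<and> B#} \<Rrightarrow> \<Delta>)"
| and_left2: "stl_rule R [\<Gamma> + {#B#} \<Rrightarrow> \<Delta>] (\<Gamma> + {#A \<^bold>\<and> B#} \<Rrightarrow> \<Delta>)"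
| and_right: "stl_rule R [\<Gamma> \<Rrightarrow> {#A#}, \<Gamma> \<Rrightarrow> {#B#}] (\<Gamma> \<Rrightarrow> {#A \<^bold>\<and> B#})"
| or_left: "stl_rule R [{#A#} \<Rrightarrow> \<Delta>, {#B#} \<Rrightarrow> \<Delta>] ({#A \<^bold>\<or> B#} \<Rrightarrow> \<Delta>)"
| or_right1: "stl_rule R [\<Gamma> \<Rrightarrow> {#A#}] (\<Gamma> \<Rrightarrow> {#A \<^bold>\<or> B#})"
| or_right2: "stl_rule R [\<Gamma> \<Rrightarrow> {#B#}] (\<Gamma> \<Rrightarrow> {#A \<^bold>\<or> B#})"
| nabla: "stl_rule R [{#A#} \<Rrightarrow> {#B#}] ({#\<^bold>\<nabla> A#} \<Rrightarrow> {#\<^bold>\<nabla> B#})"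
| imp_left: "stl_rule R [\<Gamma> \<Rrightarrow> {#A#}, \<Gamma> + {#B#} \<Rrightarrow> \<Delta>] (\<Gamma> + {#\<^bold>\<nabla> (A \<^bold>\<rightarrow> B)#} \<Rrightarrow> \<Delta>)"
| imp_right: "stl_rule R [Nablas \<Gamma> + {#A#} \<Rrightarrow> {#B#}] (\<Gamma> \<Rrightarrow> {#A \<^bold>\<rightarrow> B#})"
| rule_N: "N \<in> R \<Longrightarrow> stl_rule R [\<Gamma> \<Rrightarrow> \<Delta>] (Nablas \<Gamma> \<Rrightarrow> Nablas \<Delta>)"
| rule_D: "D \<in> R \<Longrightarrow>
    stl_rule R [\<Gamma> + {#A#} \<Rrightarrow> \<Delta>, \<Gamma> + {#B#} \<Rrightarrow> \<Delta>] (\<Gamma> + {#A \<^bold>\<or> B#} \<Rrightarrow> \<Delta>)"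
| rule_Fa: "Fa \<in> R \<Longrightarrow>
    stl_rule R [\<Gamma> + {#A#} \<Rrightarrow> {#B#}] (\<Gamma> \<Rrightarrow> {#\<^bold>\<nabla> (A \<^bold>\<rightarrow> B)#})"
| rule_Fu: "Fu \<in> R \<Longrightarrow>
    stl_rule R [Nablas \<Gamma> \<Rrightarrow> {#A#}, Nablas \<Gamma> + {#B#} \<Rrightarrow> Nablas \<Delta>]
      (\<Gamma> + {#A \<^bold>\<rightarrow> B#} \<Rrightarrow> \<Delta>)"
| rule_H_left: "H \<in> R \<Longrightarrow>
    stl_rule R [\<Gamma> \<Rrightarrow> {#A#}, \<Gamma> + {#B#} \<Rrightarrow> \<Delta>] (\<Gamma> + {#A \<^bold>\<supset> B#} \<Rrightarrow> \<Delta>)"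
| rule_H_right: "H \<in> R \<Longrightarrow>
    stl_rule R [\<Gamma> + {#A#} \<Rrightarrow> {#B#}] (\<Gamma> \<Rrightarrow> {#A \<^bold>\<supset> B#})"

inductive derives :: "axiom_name set \<Rightarrow> 'p sequent set \<Rightarrow> 'p sequent \<Rightarrow> bool"
  for R :: "axiom_name set" and \<S> :: "'p sequent set" where
  hyp: "S \<in> \<S> \<Longrightarrow> S \<in> sequents R \<Longrightarrow> derives R \<S> S"
| step: "stl_rule R Ps S \<Longrightarrow> (\<forall>P \<in> set Ps. derives R \<S> P) \<Longrightarrow> S \<in> sequents R
    \<Longrightarrow> derives R \<S> S"

definition dyn_top_system :: "axiom_name set \<Rightarrow> 'x topology \<Rightarrow> ('x \<Rightarrow> 'x) \<Rightarrow> bool" where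
  "dyn_top_system C X f \<longleftrightarrow>
     continuous_map X X f \<and>
     (Fa \<in> C \<longrightarrow> embedding_map X X f) \<and>
     (Fu \<in> C \<longrightarrow> f ` topspace X = topspace X)"

definition preimage :: "'x topology \<Rightarrow> ('x \<Rightarrow> 'x) \<Rightarrow> 'x set \<Rightarrow> 'x set" where
  "preimage X f W = {x \<in> topspace X. f x \<in> W}"

definition direct_image :: "'x topology \<Rightarrow> ('x \<Rightarrow> 'x) \<Rightarrow> 'x set \<Rightarrow> 'x set" where
  "direct_image X f U = \<Union>{W. openin X W \<and> preimage X f W \<subseteq> U}"

text \<open>\<open>direct_image\<close> is the operation \<open>f\<^sub>*\<close>: it maps opens to opens and is right adjoint to
  the preimage on open sets, which determines it uniquely.\<close>

lemma openin_direct_image: "openin X (direct_image X f U)"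
  unfolding direct_image_def by auto

lemma direct_image_adjoint:
  assumes "openin X W"
  shows "preimage X f W \<subseteq> U \<longleftrightarrow> W \<subseteq> direct_image X f U"
  using assms unfolding direct_image_def preimage_def by blast

text \<open>For models of the language without \<open>\<^bold>\<supset>\<close>, the values on formulas containing \<open>\<^bold>\<supset>\<close> are
  determined by those on the atoms and impose no further constraint.\<close>

definition top_model :: "'x topology \<Rightarrow> ('x \<Rightarrow> 'x) \<Rightarrow> ('p fm \<Rightarrow> 'x set) \<Rightarrow> bool" where
  "top_model X f V \<longleftrightarrow>
     (\<forall>A. openin X (V A)) \<and>
     V \<^bold>\<top> = topspace X \<and>
     V \<^bold>\<bottom> = {} \<and>
     (\<forall>A B. V (A \<^bold>\<and> B) = V A \<inter> V B) \<and>
     (\<forall>A B. V (A \<^bold>\<or> B) = V A \<union> V B) \<and>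
     (\<forall>A. V (\<^bold>\<nabla> A) = preimage X f (V A)) \<and>
     (\<forall>A B. V (A \<^bold>\<supset> B) = X interior_of ((topspace X - V A) \<union> V B)) \<and>
     (\<forall>A B. V (A \<^bold>\<rightarrow> B) =
        direct_image X f (X interior_of ((topspace X - V A) \<union> V B)))"

definition validates :: "'x topology \<Rightarrow> ('p fm \<Rightarrow> 'x set) \<Rightarrow> 'p sequent \<Rightarrow> bool" where
  "validates X V S \<longleftrightarrow>
     topspace X \<inter> (\<Inter>\<gamma> \<in> set_mset (antecedent S). V \<gamma>)
       \<subseteq> (\<Union>\<delta> \<in> set_mset (succedent S). V \<delta>)"

text \<open>Consequence over the systems in \<open>T(C)\<close> whose points are taken from the type \<open>'x\<close>. The
  carrier \<open>topspace X\<close> may be any subset of the type. HOL formulas cannot quantify over types;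
  consequence over all systems is the conjunction of \<open>entails TYPE('x)\<close> over all \<open>'x\<close>. It is
  captured by soundness for an arbitrary \<open>'x\<close> together with completeness for one fixed type of
  points, sets of formulas.\<close>

definition entails ::
  "'x itself \<Rightarrow> axiom_name set \<Rightarrow> 'p sequent set \<Rightarrow> 'p sequent \<Rightarrow> bool" where
  "entails _ C \<S> S \<longleftrightarrow>
     (\<forall>(X :: 'x topology) f V. dyn_top_system C X f \<longrightarrow> top_model X f V \<longrightarrow>
        (\<forall>S' \<in> \<S>. validates X V S') \<longrightarrow> validates X V S)"

end

theory Submission
  imports Defs
begin

text \<open>Soundness follows from the two adjunctions \<open>f\<^sup>-\<^sup>1 \<stileturn> f\<^sub>*\<close> and \<open>_ \<inter> U \<stileturn> int (U\<^sup>c \<union> _)\<close>: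
  together they say that an open set \<open>W\<close> lies below \<open>V (A \<rightarrow> B)\<close> iff \<open>f\<^sup>-\<^sup>1 W \<inter> V A \<subseteq> V B\<close>.

  For completeness, take the prime theories over \<open>\<S>\<close> with the topology of all sets upward closed
  under inclusion, and the map sending \<open>P\<close> to \<open>{A. \<nabla>A \<in> P}\<close>. Rule (N) and the adjunction between
  \<open>\<nabla>\<close> and \<open>\<top> \<rightarrow> _\<close>, which makes \<open>\<nabla>\<close> preserve disjunctions, show that this theory is again prime.
  Under (Fa) \<open>A\<close> is equivalent to \<open>\<nabla>(\<top> \<rightarrow> A)\<close>, so the map reflects inclusion and is an embedding.
  Under (Fu) \<open>\<nabla>\<close> reflects entailment, so for a prime \<open>P\<close> the theory generated by \<open>\<nabla>P\<close> avoids every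
  \<open>\<nabla>E\<close> with \<open>E \<notin> P\<close>; a prime extension avoiding all of them is mapped to \<open>P\<close>.\<close>

section \<open>Preimages and interiors\<close>

lemma subset_interior_of_implication_iff:
  assumes "openin X W"
  shows "W \<subseteq> X interior_of ((topspace X - U) \<union> V) \<longleftrightarrow> W \<inter> U \<subseteq> V"
  using openin_subset[OF assms] by (auto simp: interior_of_maximal_eq[OF assms])

lemma openin_preimage:
  assumes "continuous_map X Y f" "openin Y W"
  shows "openin X (preimage X f W)"
  using assms unfolding preimage_def by (rule openin_continuous_map_preimage)

lemma preimage_mono: "U \<subseteq> W \<Longrightarrow> preimage X f U \<subseteq> preimage X f W"
  by (auto simp: preimage_def)

lemma preimage_subset_preimage_iff:
  assumes "f ` topspace X = topspace Y" "U \<subseteq> topspace Y"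
  shows "preimage X f U \<subseteq> preimage X f W \<longleftrightarrow> U \<subseteq> W"
proof
  assume sub: "preimage X f U \<subseteq> preimage X f W"
  show "U \<subseteq> W"
  proof
    fix y assume "y \<in> U"
    moreover from this obtain x where "x \<in> topspace X" "y = f x"
      using assms by blast
    ultimately show "y \<in> W"
      using sub by (auto simp: preimage_def)
  qed
qed (rule preimage_mono)

lemma embedding_map_open_is_preimage:
  assumes "embedding_map X Y f" "openin X U"
  obtains W where "openin Y W" "preimage X f W = U"
proof -
  let ?Y = "subtopology Y (f ` topspace X)"
  have hom: "homeomorphic_map X ?Y f"
    using assms(1) by (simp add: embedding_map_def)
  have U: "U \<subseteq> topspace X"
    by (rule openin_subset[OF assms(2)])
  have "openin ?Y (f ` U)"
    using homeomorphic_map_openness[OF hom U] assms(2) by simp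
  then obtain W where W: "openin Y W" "f ` U = W \<inter> f ` topspace X"
    by (auto simp: openin_subtopology)
  moreover have "inj_on f (topspace X)"
    using hom by (rule homeomorphic_imp_injective_map)
  ultimately have "preimage X f W = U"
    using U unfolding preimage_def by (auto dest: inj_on_image_mem_iff)
  with W(1) show thesis by (rule that)
qed

section \<open>The topology of upward closed sets\<close>

definition upset_topology :: "'a::preorder set \<Rightarrow> 'a topology" where
  "upset_topology S = topology (\<lambda>U. U \<subseteq> S \<and> (\<forall>x \<in> U. \<forall>y \<in> S. x \<le> y \<longrightarrow> y \<in> U))"

lemma openin_upset_topology:
  "openin (upset_topology S) U \<longleftrightarrow> U \<subseteq> S \<and> (\<forall>x \<in> U. \<forall>y \<in> S. x \<le> y \<longrightarrow> y \<in> U)"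
proof -
  have "istopology (\<lambda>U. U \<subseteq> S \<and> (\<forall>x \<in> U. \<forall>y \<in> S. x \<le> y \<longrightarrow> y \<in> U))"
    unfolding istopology_def by blast
  then show ?thesis
    unfolding upset_topology_def by (simp add: topology_inverse')
qed

lemma topspace_upset_topology [simp]: "topspace (upset_topology S) = S"
proof (rule equalityI)
  show "topspace (upset_topology S) \<subseteq> S"
    using openin_topspace[of "upset_topology S"] unfolding openin_upset_topology by blast
  show "S \<subseteq> topspace (upset_topology S)"
    by (rule openin_subset) (simp add: openin_upset_topology)
qed

lemma openin_upset_topology_principal: "openin (upset_topology S) {y \<in> S. x \<le> y}"
  unfolding openin_upset_topology by (blast intro: order_trans)

lemma mem_iff_principal_subset:
  assumes "openin (upset_topology S) U" "x \<in> S"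
  shows "x \<in> U \<longleftrightarrow> {y \<in> S. x \<le> y} \<subseteq> U"
  using assms unfolding openin_upset_topology by blast

lemma subtopology_upset_topology:
  assumes "T \<subseteq> S"
  shows "subtopology (upset_topology S) T = upset_topology T"
  unfolding topology_eq
proof
  fix U
  show "openin (subtopology (upset_topology S) T) U \<longleftrightarrow> openin (upset_topology T) U"
  proof
    assume "openin (upset_topology T) U"
    then have U: "U \<subseteq> T" "\<And>x y. x \<in> U \<Longrightarrow> y \<in> T \<Longrightarrow> x \<le> y \<Longrightarrow> y \<in> U"
      unfolding openin_upset_topology by blast+
    let ?W = "{y \<in> S. \<exists>x \<in> U. x \<le> y}"
    have "openin (upset_topology S) ?W"
      unfolding openin_upset_topology by (blast intro: order_trans)
    moreover have "U = ?W \<inter> T"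
      using U assms by blast
    ultimately show "openin (subtopology (upset_topology S) T) U"
      unfolding openin_subtopology by blast
  next
    assume "openin (subtopology (upset_topology S) T) U"
    then show "openin (upset_topology T) U"
      using assms unfolding openin_subtopology openin_upset_topology by blast
  qed
qed

lemma continuous_map_upset_topology:
  assumes "f \<in> S \<rightarrow> T" "mono_on S f"
  shows "continuous_map (upset_topology S) (upset_topology T) f"
  unfolding continuous_map
  using assms by (fastforce simp: openin_upset_topology dest: mono_onD)

lemma embedding_map_upset_topology:
  fixes f :: "'a::order \<Rightarrow> 'b::preorder"
  assumes f: "f \<in> S \<rightarrow> T" and le_iff: "\<And>x y. x \<in> S \<Longrightarrow> y \<in> S \<Longrightarrow> f x \<le> f y \<longleftrightarrow> x \<le> y"
  shows "embedding_map (upset_topology S) (upset_topology T) f"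
proof -
  have inj: "inj_on f S"
    by (rule inj_onI) (metis le_iff order_antisym order_refl)
  have "continuous_map (upset_topology S) (upset_topology (f ` S)) f"
    by (rule continuous_map_upset_topology) (auto intro: mono_onI simp: le_iff)
  moreover have "continuous_map (upset_topology (f ` S)) (upset_topology S) (inv_into S f)"
    by (rule continuous_map_upset_topology)
      (auto intro!: mono_onI inv_into_into simp: inv_into_f_f[OF inj] le_iff)
  ultimately have "homeomorphic_maps (upset_topology S) (upset_topology (f ` S)) f (inv_into S f)"
    by (auto simp: homeomorphic_maps_def inv_into_f_f[OF inj])
  moreover have "subtopology (upset_topology T) (f ` S) = upset_topology (f ` S)"
    using f by (intro subtopology_upset_topology) blast
  ultimately show ?thesis
    by (auto simp: embedding_map_def homeomorphic_map_maps)
qed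

section \<open>Topological models and soundness\<close>

primrec extend_valuation :: "'x topology \<Rightarrow> ('x \<Rightarrow> 'x) \<Rightarrow> ('p \<Rightarrow> 'x set) \<Rightarrow> 'p fm \<Rightarrow> 'x set" where
  "extend_valuation X f v (Atom p) = v p"
| "extend_valuation X f v \<^bold>\<top> = topspace X"
| "extend_valuation X f v \<^bold>\<bottom> = {}"
| "extend_valuation X f v (A \<^bold>\<and> B) = extend_valuation X f v A \<inter> extend_valuation X f v B"
| "extend_valuation X f v (A \<^bold>\<or> B) = extend_valuation X f v A \<union> extend_valuation X f v B"
| "extend_valuation X f v (A \<^bold>\<rightarrow> B) = direct_image X f
     (X interior_of ((topspace X - extend_valuation X f v A) \<union> extend_valuation X f v B))"
| "extend_valuation X f v (\<^bold>\<nabla> A) = preimage X f (extend_valuation X f v A)"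
| "extend_valuation X f v (A \<^bold>\<supset> B) =
     X interior_of ((topspace X - extend_valuation X f v A) \<union> extend_valuation X f v B)"

lemma top_model_extend_valuation:
  assumes "continuous_map X X f" "\<And>p. openin X (v p)"
  shows "top_model X f (extend_valuation X f v)"
proof -
  have "openin X (extend_valuation X f v A)" for A
    by (induction A)
      (use assms in \<open>simp_all add: openin_direct_image openin_preimage openin_Int openin_Un\<close>)
  then show ?thesis
    by (simp add: top_model_def)
qed

locale topological_model =
  fixes X :: "'x topology" and f :: "'x \<Rightarrow> 'x" and V :: "'p fm \<Rightarrow> 'x set"
  assumes continuous: "continuous_map X X f" and top_model: "top_model X f V"
begin

lemma openin_val: "openin X (V A)"
  using top_model by (simp add: top_model_def)

lemma val_simps [simp]:
  "V \<^bold>\<top> = topspace X" "V \<^bold>\<bottom> = {}" "V (A \<^bold>\<and> B) = V A \<inter> V B" "V (A \<^bold>\<or> B) = V A \<union> V B"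
  "V (\<^bold>\<nabla> A) = preimage X f (V A)"
  using top_model by (simp_all add: top_model_def)

lemma subset_val_himp_iff:
  assumes "openin X W"
  shows "W \<subseteq> V (A \<^bold>\<supset> B) \<longleftrightarrow> W \<inter> V A \<subseteq> V B"
  using subset_interior_of_implication_iff[OF assms] top_model by (simp add: top_model_def)

lemma subset_val_imp_iff:
  assumes "openin X W"
  shows "W \<subseteq> V (A \<^bold>\<rightarrow> B) \<longleftrightarrow> preimage X f W \<inter> V A \<subseteq> V B"
proof -
  have "W \<subseteq> V (A \<^bold>\<rightarrow> B) \<longleftrightarrow> preimage X f W \<subseteq> V (A \<^bold>\<supset> B)"
    using direct_image_adjoint[OF assms] top_model by (simp add: top_model_def)
  also have "\<dots> \<longleftrightarrow> preimage X f W \<inter> V A \<subseteq> V B"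
    by (rule subset_val_himp_iff[OF openin_preimage[OF continuous assms]])
  finally show ?thesis .
qed

lemma val_himp_mp: "V (A \<^bold>\<supset> B) \<inter> V A \<subseteq> V B"
  using subset_val_himp_iff[OF openin_val] by blast

lemma val_imp_mp: "preimage X f (V (A \<^bold>\<rightarrow> B)) \<inter> V A \<subseteq> V B"
  using subset_val_imp_iff[OF openin_val] by blast

definition antecedent_val :: "'p fm multiset \<Rightarrow> 'x set" where
  "antecedent_val \<Gamma> = topspace X \<inter> (\<Inter>\<gamma> \<in> set_mset \<Gamma>. V \<gamma>)"

definition succedent_val :: "'p fm multiset \<Rightarrow> 'x set" where
  "succedent_val \<Delta> = (\<Union>\<delta> \<in> set_mset \<Delta>. V \<delta>)"

lemma validates_iff: "validates X V (\<Gamma> \<Rrightarrow> \<Delta>) \<longleftrightarrow> antecedent_val \<Gamma> \<subseteq> succedent_val \<Delta>"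
  by (simp add: validates_def antecedent_val_def succedent_val_def)

lemma antecedent_val_simps [simp]:
  "antecedent_val {#} = topspace X"
  "antecedent_val (add_mset A \<Gamma>) = V A \<inter> antecedent_val \<Gamma>"
  "antecedent_val (\<Gamma> + \<Theta>) = antecedent_val \<Gamma> \<inter> antecedent_val \<Theta>"
  by (auto simp: antecedent_val_def)

lemma succedent_val_simps [simp]:
  "succedent_val {#} = {}"
  "succedent_val {#A#} = V A"
  by (auto simp: succedent_val_def)

lemma antecedent_val_Nablas [simp]: "antecedent_val (Nablas \<Gamma>) = preimage X f (antecedent_val \<Gamma>)"
  using continuous_map_image_subset_topspace[OF continuous]
  by (auto simp: antecedent_val_def preimage_def)

lemma succedent_val_Nablas [simp]: "succedent_val (Nablas \<Delta>) = preimage X f (succedent_val \<Delta>)"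
  by (auto simp: succedent_val_def preimage_def)

lemma openin_antecedent_val: "openin X (antecedent_val \<Gamma>)"
  by (induction \<Gamma>) (simp_all add: openin_val openin_Int)

lemma antecedent_val_subset: "antecedent_val \<Gamma> \<subseteq> topspace X"
  by (rule openin_subset[OF openin_antecedent_val])

lemma embedding_subset_nabla_imp:
  assumes "embedding_map X X f" "openin X U" "U \<inter> V A \<subseteq> V B"
  shows "U \<subseteq> V (\<^bold>\<nabla> (A \<^bold>\<rightarrow> B))"
proof -
  obtain W where W: "openin X W" "preimage X f W = U"
    using embedding_map_open_is_preimage[OF assms(1,2)] .
  then have "W \<subseteq> V (A \<^bold>\<rightarrow> B)"
    using assms(3) by (simp add: subset_val_imp_iff)
  then show ?thesis
    using W(2) preimage_mono[of W "V (A \<^bold>\<rightarrow> B)" X f] by simp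
qed

lemma surjective_inter_imp_subset:
  assumes surj: "f ` topspace X = topspace X" and U: "U \<subseteq> topspace X"
    and minor: "preimage X f U \<subseteq> V A" "preimage X f U \<inter> V B \<subseteq> preimage X f W"
  shows "U \<inter> V (A \<^bold>\<rightarrow> B) \<subseteq> W"
proof -
  have "preimage X f (U \<inter> V (A \<^bold>\<rightarrow> B)) \<subseteq> preimage X f U \<inter> V B"
    using minor(1) val_imp_mp[of A B] by (auto simp: preimage_def)
  also have "\<dots> \<subseteq> preimage X f W"
    by (rule minor(2))
  finally show ?thesis
    using U by (simp add: preimage_subset_preimage_iff[OF surj] le_infI1)
qed

lemma stl_rule_sound:
  assumes rule: "stl_rule R Ps S" and prems: "\<forall>P \<in> set Ps. validates X V P"
    and faithful: "Fa \<in> R \<Longrightarrow> embedding_map X X f"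
    and full: "Fu \<in> R \<Longrightarrow> f ` topspace X = topspace X"
  shows "validates X V S"
  using rule
proof cases
  case (nabla A B)
  then show ?thesis
    using prems openin_subset[OF openin_val] by (auto simp: validates_iff preimage_def)
next
  case (imp_left \<Gamma> A B \<Delta>)
  then show ?thesis using prems val_imp_mp[of A B] by (auto simp: validates_iff)
next
  case (imp_right \<Gamma> A B)
  then show ?thesis
    using prems subset_val_imp_iff[OF openin_antecedent_val, of \<Gamma> A B]
    by (auto simp: validates_iff)
next
  case (rule_N \<Gamma> \<Delta>)
  then show ?thesis using prems by (simp add: validates_iff preimage_mono)
next
  case (rule_Fa \<Gamma> A B)
  then have "antecedent_val \<Gamma> \<subseteq> V (\<^bold>\<nabla> (A \<^bold>\<rightarrow> B))"
    using prems
    by (intro embedding_subset_nabla_imp faithful openin_antecedent_val) (auto simp: validates_iff)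
  then show ?thesis using rule_Fa by (simp add: validates_iff)
next
  case (rule_Fu \<Gamma> A B \<Delta>)
  then have "antecedent_val \<Gamma> \<inter> V (A \<^bold>\<rightarrow> B) \<subseteq> succedent_val \<Delta>"
    using prems
    by (intro surjective_inter_imp_subset full antecedent_val_subset) (auto simp: validates_iff)
  then show ?thesis using rule_Fu antecedent_val_subset by (auto simp: validates_iff)
next
  case (rule_H_left \<Gamma> A B \<Delta>)
  then show ?thesis using prems val_himp_mp[of A B] by (auto simp: validates_iff)
next
  case (rule_H_right \<Gamma> A B)
  then show ?thesis
    using prems subset_val_himp_iff[OF openin_antecedent_val, of \<Gamma> A B]
    by (auto simp: validates_iff)
qed (use prems in \<open>auto simp: validates_iff\<close>)

end

theorem soundness:
  assumes "derives R \<S> S" "R \<inter> {Fa, Fu} \<subseteq> C"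
  shows "entails TYPE('x) C \<S> S"
  unfolding entails_def
proof (intro allI impI)
  fix X :: "'x topology" and f V
  assume sys: "dyn_top_system C X f" and "top_model X f V" and hyps: "\<forall>S' \<in> \<S>. validates X V S'"
  then interpret topological_model X f V
    by unfold_locales (simp_all add: dyn_top_system_def)
  from assms(1) show "validates X V S"
  proof induction
    case (hyp S)
    then show ?case using hyps by blast
  next
    case (step Ps S)
    then show ?case
      using sys assms(2) by (intro stl_rule_sound[OF step.hyps(1)]) (auto simp: dyn_top_system_def)
  qed
qed

section \<open>Prime theories of a disjunctive consequence relation\<close>

locale consequence_relation =
  fixes L :: "'a set"
    and consequence :: "'a set \<Rightarrow> 'a \<Rightarrow> bool" (infix \<open>\<tturnstile>\<close> 55)
  assumes consequence_in_language: "T \<tturnstile> A \<Longrightarrow> A \<in> L"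
    and assumption: "A \<in> T \<Longrightarrow> A \<in> L \<Longrightarrow> T \<tturnstile> A"
    and monotone: "T \<tturnstile> A \<Longrightarrow> T \<subseteq> U \<Longrightarrow> U \<tturnstile> A"
    and cut: "T \<tturnstile> A \<Longrightarrow> insert A T \<tturnstile> B \<Longrightarrow> T \<tturnstile> B"
    and finitary: "T \<tturnstile> A \<Longrightarrow> \<exists>F. finite F \<and> F \<subseteq> T \<and> F \<tturnstile> A"
begin

lemma cut_single:
  assumes "T \<tturnstile> A" "{A} \<tturnstile> B"
  shows "T \<tturnstile> B"
  using assms(1) by (rule cut) (rule monotone[OF assms(2)], simp)

lemma cut_pair:
  assumes "T \<tturnstile> A" "T \<tturnstile> B" "{A, B} \<tturnstile> C"
  shows "T \<tturnstile> C"
proof -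
  have "insert A T \<tturnstile> B"
    by (rule monotone[OF assms(2)]) blast
  moreover have "insert B (insert A T) \<tturnstile> C"
    by (rule monotone[OF assms(3)]) blast
  ultimately have "insert A T \<tturnstile> C"
    by (rule cut)
  with assms(1) show ?thesis
    by (rule cut)
qed

definition avoids :: "'a set \<Rightarrow> 'a set \<Rightarrow> bool" where
  "avoids T I \<longleftrightarrow> (\<forall>E \<in> I. \<not> T \<tturnstile> E)"

definition directed :: "'a set \<Rightarrow> bool" where
  "directed I \<longleftrightarrow> (\<forall>E \<in> I. \<forall>F \<in> I. \<exists>G \<in> I. {E} \<tturnstile> G \<and> {F} \<tturnstile> G)"

lemma avoids_Union_chain:
  assumes "subset.chain {P. avoids P I} K" "K \<noteq> {}"
  shows "avoids (\<Union>K) I"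
  unfolding avoids_def
proof (intro ballI notI)
  fix E assume "E \<in> I" "\<Union>K \<tturnstile> E"
  then obtain F where F: "finite F" "F \<subseteq> \<Union>K" "F \<tturnstile> E"
    using finitary by blast
  obtain Z where "Z \<in> K" "F \<subseteq> Z"
    using finite_subset_Union_chain[OF F(1,2) assms(2,1)] .
  then have "avoids Z I" "Z \<tturnstile> E"
    using assms(1) F(3) monotone by (auto simp: subset.chain_def)
  with \<open>E \<in> I\<close> show False
    by (simp add: avoids_def)
qed

lemma maximal_avoiding_exists:
  assumes "T \<subseteq> L" "avoids T I"
  obtains P where "T \<subseteq> P" "P \<subseteq> L" "avoids P I" "\<And>A. A \<in> L \<Longrightarrow> A \<notin> P \<Longrightarrow> \<not> avoids (insert A P) I"
proof -
  let ?\<A> = "{P. T \<subseteq> P \<and> P \<subseteq> L \<and> avoids P I}"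
  have "\<exists>M \<in> ?\<A>. \<forall>Q \<in> ?\<A>. M \<subseteq> Q \<longrightarrow> Q = M"
  proof (rule subset_Zorn_nonempty)
    show "?\<A> \<noteq> {}"
      using assms by blast
    fix K assume K: "K \<noteq> {}" "subset.chain ?\<A> K"
    then have "K \<subseteq> ?\<A>" "subset.chain {P. avoids P I} K"
      by (auto simp: subset.chain_def)
    with K(1) show "\<Union>K \<in> ?\<A>"
      using avoids_Union_chain by fast
  qed
  then obtain P where P: "P \<in> ?\<A>" and max: "\<forall>Q \<in> ?\<A>. P \<subseteq> Q \<longrightarrow> Q = P"
    by (rule bexE)
  have ext: "\<not> avoids (insert A P) I" if "A \<in> L" "A \<notin> P" for A
    using bspec[OF max, of "insert A P"] P that by blast
  show thesis
    by (rule that[OF _ _ _ ext]) (use P in auto)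
qed

end

locale disjunctive_consequence = consequence_relation +
  fixes disj :: "'a \<Rightarrow> 'a \<Rightarrow> 'a" (infixr \<open>\<oplus>\<close> 65)
  assumes disj_in_language: "A \<oplus> B \<in> L \<longleftrightarrow> A \<in> L \<and> B \<in> L"
    and disj_intro1: "T \<tturnstile> A \<Longrightarrow> B \<in> L \<Longrightarrow> T \<tturnstile> A \<oplus> B"
    and disj_intro2: "T \<tturnstile> B \<Longrightarrow> A \<in> L \<Longrightarrow> T \<tturnstile> A \<oplus> B"
    and disj_elim: "A \<in> L \<Longrightarrow> B \<in> L \<Longrightarrow> insert A T \<tturnstile> E \<Longrightarrow> insert B T \<tturnstile> E \<Longrightarrow> insert (A \<oplus> B) T \<tturnstile> E"
begin

definition prime_theory :: "'a set \<Rightarrow> bool" where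
  "prime_theory P \<longleftrightarrow>
     P \<subset> L \<and> (\<forall>A. P \<tturnstile> A \<longrightarrow> A \<in> P) \<and> (\<forall>A B. A \<oplus> B \<in> P \<longrightarrow> A \<in> P \<or> B \<in> P)"

lemma prime_theory_subset: "prime_theory P \<Longrightarrow> P \<subseteq> L"
  by (auto simp: prime_theory_def)

lemma prime_theory_consequence_iff: "prime_theory P \<Longrightarrow> P \<tturnstile> A \<longleftrightarrow> A \<in> P"
  by (auto simp: prime_theory_def intro: assumption)

lemma prime_theory_closed: "prime_theory P \<Longrightarrow> T \<subseteq> P \<Longrightarrow> T \<tturnstile> A \<Longrightarrow> A \<in> P"
  using monotone prime_theory_consequence_iff by blast

lemma prime_theory_disj_iff:
  assumes "prime_theory P" "A \<in> L" "B \<in> L"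
  shows "A \<oplus> B \<in> P \<longleftrightarrow> A \<in> P \<or> B \<in> P"
proof
  assume "A \<in> P \<or> B \<in> P"
  then have "P \<tturnstile> A \<oplus> B"
    using assms assumption disj_intro1 disj_intro2 by blast
  then show "A \<oplus> B \<in> P"
    using prime_theory_consequence_iff[OF assms(1)] by blast
qed (use assms(1) in \<open>simp add: prime_theory_def\<close>)

lemma maximal_avoiding_prime_theory:
  assumes P: "P \<subseteq> L" "avoids P I" and I: "I \<subseteq> L" "I \<noteq> {}" "directed I"
    and max: "\<And>A. A \<in> L \<Longrightarrow> A \<notin> P \<Longrightarrow> \<not> avoids (insert A P) I"
  shows "prime_theory P"
  unfolding prime_theory_def
proof (intro conjI allI impI)
  obtain E where "E \<in> I" "E \<notin> P"
    using P(2) I(1,2) assumption unfolding avoids_def by blast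
  then show "P \<subset> L"
    using P(1) I(1) by blast
next
  fix A assume "P \<tturnstile> A"
  then have "avoids (insert A P) I"
    using P(2) cut[OF \<open>P \<tturnstile> A\<close>] unfolding avoids_def by blast
  then show "A \<in> P"
    using max consequence_in_language[OF \<open>P \<tturnstile> A\<close>] by blast
next
  fix A B assume AB: "A \<oplus> B \<in> P"
  then have L: "A \<in> L" "B \<in> L"
    using P(1) disj_in_language by blast+
  show "A \<in> P \<or> B \<in> P"
  proof (rule ccontr)
    assume "\<not> (A \<in> P \<or> B \<in> P)"
    then obtain E F where EF: "E \<in> I" "insert A P \<tturnstile> E" "F \<in> I" "insert B P \<tturnstile> F"
      using max L unfolding avoids_def by metis
    then obtain G where G: "G \<in> I" "{E} \<tturnstile> G" "{F} \<tturnstile> G"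
      using I(3) unfolding directed_def by blast
    have "insert (A \<oplus> B) P \<tturnstile> G"
      using EF G L by (intro disj_elim) (auto intro: cut_single)
    then show False
      using P(2) G(1) AB by (simp add: avoids_def insert_absorb)
  qed
qed

lemma prime_theory_extension:
  assumes "T \<subseteq> L" "I \<subseteq> L" "I \<noteq> {}" "directed I" "avoids T I"
  obtains P where "prime_theory P" "T \<subseteq> P" "P \<inter> I = {}"
proof -
  obtain P where P: "T \<subseteq> P" "P \<subseteq> L" "avoids P I"
    and max: "\<And>A. A \<in> L \<Longrightarrow> A \<notin> P \<Longrightarrow> \<not> avoids (insert A P) I"
    using maximal_avoiding_exists assms by metis
  have "prime_theory P"
    using P(2,3) assms(2-4) max by (rule maximal_avoiding_prime_theory)
  moreover have "P \<inter> I = {}"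
    using P(2,3) assumption by (auto simp: avoids_def)
  ultimately show thesis
    using that P(1) by blast
qed

theorem consequence_iff_prime_theories:
  assumes "T \<subseteq> L" "A \<in> L"
  shows "T \<tturnstile> A \<longleftrightarrow> (\<forall>P. prime_theory P \<longrightarrow> T \<subseteq> P \<longrightarrow> A \<in> P)"
proof
  assume "T \<tturnstile> A"
  then show "\<forall>P. prime_theory P \<longrightarrow> T \<subseteq> P \<longrightarrow> A \<in> P"
    using prime_theory_closed by blast
next
  assume all: "\<forall>P. prime_theory P \<longrightarrow> T \<subseteq> P \<longrightarrow> A \<in> P"
  show "T \<tturnstile> A"
  proof (rule ccontr)
    assume "\<not> T \<tturnstile> A"
    then have "avoids T {A}"
      by (simp add: avoids_def)
    moreover have "directed {A}"
      using assms(2) by (simp add: directed_def assumption)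
    ultimately obtain P where "prime_theory P" "T \<subseteq> P" "P \<inter> {A} = {}"
      using prime_theory_extension[of T "{A}"] assms by blast
    with all show False
      by blast
  qed
qed

end

section \<open>Consequence between sets of formulas\<close>

lemma sequents_iff [simp]:
  "(\<Gamma> \<Rrightarrow> \<Delta>) \<in> sequents R \<longleftrightarrow>
     size \<Delta> \<le> 1 \<and> set_mset \<Gamma> \<subseteq> language R \<and> set_mset \<Delta> \<subseteq> language R"
  by (simp add: sequents_def)

lemma language_simps [simp]:
  "\<^bold>\<top> \<in> language R"
  "\<^bold>\<bottom> \<in> language R"
  "A \<^bold>\<and> B \<in> language R \<longleftrightarrow> A \<in> language R \<and> B \<in> language R"
  "A \<^bold>\<or> B \<in> language R \<longleftrightarrow> A \<in> language R \<and> B \<in> language R"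
  "A \<^bold>\<rightarrow> B \<in> language R \<longleftrightarrow> A \<in> language R \<and> B \<in> language R"
  "\<^bold>\<nabla> A \<in> language R \<longleftrightarrow> A \<in> language R"
  "A \<^bold>\<supset> B \<in> language R \<longleftrightarrow> H \<in> R \<and> A \<in> language R \<and> B \<in> language R"
  by (auto simp: language_def)

lemma derives_in_sequents: "derives R \<S> S \<Longrightarrow> S \<in> sequents R"
  by (induction rule: derives.induct) auto

lemma image_mset_of_subset_image:
  assumes "set_mset \<Gamma> \<subseteq> g ` T"
  obtains \<Theta> where "set_mset \<Theta> \<subseteq> T" "\<Gamma> = image_mset g \<Theta>"
proof
  show "set_mset (image_mset (inv_into T g) \<Gamma>) \<subseteq> T"
    using assms by (auto intro: inv_into_into)
  show "\<Gamma> = image_mset g (image_mset (inv_into T g) \<Gamma>)"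
    using assms
    by (auto simp: f_inv_into_f multiset.map_comp intro!: multiset.map_ident_strong[symmetric])
qed

locale stl_calculus =
  fixes R :: "axiom_name set" and \<S> :: "'p sequent set"
begin

abbreviation derivable :: "'p fm multiset \<Rightarrow> 'p fm multiset \<Rightarrow> bool" (infix \<open>\<turnstile>\<close> 55) where
  "\<Gamma> \<turnstile> \<Delta> \<equiv> derives R \<S> (\<Gamma> \<Rrightarrow> \<Delta>)"

abbreviation L :: "'p fm set" where
  "L \<equiv> language R"

lemma derivable_in_language:
  assumes "\<Gamma> \<turnstile> \<Delta>"
  shows "size \<Delta> \<le> 1" "set_mset \<Gamma> \<subseteq> L" "set_mset \<Delta> \<subseteq> L"
  using derives_in_sequents[OF assms] by simp_all

lemma derivable_weaken:
  assumes "\<Gamma> \<turnstile> \<Delta>" "set_mset \<Theta> \<subseteq> L"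
  shows "\<Gamma> + \<Theta> \<turnstile> \<Delta>"
  using assms(2)
proof (induction \<Theta>)
  case empty
  then show ?case using assms(1) by simp
next
  case (add A \<Theta>)
  then have prem: "\<Gamma> + \<Theta> \<turnstile> \<Delta>" by simp
  then have "\<Gamma> + \<Theta> + {#A#} \<turnstile> \<Delta>"
    using add.prems derivable_in_language[OF prem]
    by (intro derives.step[OF stl_rule.weak_left]) auto
  then show ?case by simp
qed

lemma derivable_contract:
  assumes "\<Gamma> + \<Theta> \<turnstile> \<Delta>" "set_mset \<Theta> \<subseteq> set_mset \<Gamma>"
  shows "\<Gamma> \<turnstile> \<Delta>"
  using assms
proof (induction \<Theta>)
  case empty
  then show ?case by simp
next
  case (add A \<Theta>)
  then obtain \<Gamma>' where \<Gamma>': "\<Gamma> = add_mset A \<Gamma>'"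
    by (auto dest: multi_member_split)
  have prem: "\<Gamma>' + \<Theta> + {#A, A#} \<turnstile> \<Delta>"
    using add.prems \<Gamma>' by simp
  then have "\<Gamma>' + \<Theta> + {#A#} \<turnstile> \<Delta>"
    using derivable_in_language[OF prem] by (intro derives.step[OF stl_rule.contr_left]) auto
  then show ?case
    using add \<Gamma>' by simp
qed

lemma derivable_structural:
  assumes "\<Gamma> \<turnstile> \<Delta>" "set_mset \<Gamma> \<subseteq> set_mset \<Theta>" "set_mset \<Theta> \<subseteq> L"
  shows "\<Theta> \<turnstile> \<Delta>"
  using derivable_contract[of \<Theta> \<Gamma>] derivable_weaken[OF assms(1,3)] assms(2)
  by (simp add: add.commute)

definition proves :: "'p fm set \<Rightarrow> 'p fm \<Rightarrow> bool" (infix \<open>\<tturnstile>\<close> 55) where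
  "T \<tturnstile> A \<longleftrightarrow> (\<exists>\<Gamma>. set_mset \<Gamma> \<subseteq> T \<and> \<Gamma> \<turnstile> {#A#})"

lemma provesI: "\<Gamma> \<turnstile> {#A#} \<Longrightarrow> set_mset \<Gamma> \<subseteq> T \<Longrightarrow> T \<tturnstile> A"
  by (auto simp: proves_def)

lemma proves_set_mset_iff:
  assumes "set_mset \<Gamma> \<subseteq> L"
  shows "set_mset \<Gamma> \<tturnstile> A \<longleftrightarrow> \<Gamma> \<turnstile> {#A#}"
  using assms derivable_structural by (auto simp: proves_def)

lemma proves_set_mset_Bot_iff:
  assumes "set_mset \<Gamma> \<subseteq> L"
  shows "set_mset \<Gamma> \<tturnstile> \<^bold>\<bottom> \<longleftrightarrow> \<Gamma> \<turnstile> {#}"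
  unfolding proves_set_mset_iff[OF assms]
proof
  assume "\<Gamma> \<turnstile> {#\<^bold>\<bottom>#}"
  moreover have "{#\<^bold>\<bottom>#} \<turnstile> {#}"
    by (rule derives.step[OF stl_rule.bot_left]) auto
  ultimately have "{#} + \<Gamma> \<turnstile> {#}"
    using assms by (intro derives.step[OF stl_rule.cut]) auto
  then show "\<Gamma> \<turnstile> {#}"
    by simp
next
  assume "\<Gamma> \<turnstile> {#}"
  then show "\<Gamma> \<turnstile> {#\<^bold>\<bottom>#}"
    using assms by (intro derives.step[OF stl_rule.weak_right]) auto
qed

lemma proves_insertE:
  assumes "insert A T \<tturnstile> B" "A \<in> L"
  obtains \<Gamma> where "set_mset \<Gamma> \<subseteq> T" "\<Gamma> + {#A#} \<turnstile> {#B#}"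
proof -
  obtain \<Theta> where \<Theta>: "set_mset \<Theta> \<subseteq> insert A T" "\<Theta> \<turnstile> {#B#}"
    using assms(1) by (auto simp: proves_def)
  let ?\<Gamma> = "filter_mset (\<lambda>C. C \<noteq> A) \<Theta>"
  have "?\<Gamma> + {#A#} \<turnstile> {#B#}"
    by (rule derivable_structural[OF \<Theta>(2)]) (use derivable_in_language[OF \<Theta>(2)] assms(2) in auto)
  with \<Theta>(1) that[of ?\<Gamma>] show thesis by auto
qed

sublocale consequence_relation L proves
proof
  fix T A assume "T \<tturnstile> A"
  then show "A \<in> L"
    using derivable_in_language by (fastforce simp: proves_def)
next
  fix T A assume "A \<in> T" "A \<in> L"
  then show "T \<tturnstile> A"
    by (intro provesI[OF derives.step[OF stl_rule.identity]]) auto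
next
  fix T U A assume "T \<tturnstile> A" "T \<subseteq> U"
  then show "U \<tturnstile> A"
    by (auto simp: proves_def)
next
  fix T A B assume A: "T \<tturnstile> A" and B: "insert A T \<tturnstile> B"
  obtain \<Gamma> where \<Gamma>: "set_mset \<Gamma> \<subseteq> T" "\<Gamma> \<turnstile> {#A#}"
    using A by (auto simp: proves_def)
  obtain \<Theta> where \<Theta>: "set_mset \<Theta> \<subseteq> T" "\<Theta> + {#A#} \<turnstile> {#B#}"
    using proves_insertE[OF B] derivable_in_language(3)[OF \<Gamma>(2)] by auto
  have "\<Theta> + \<Gamma> \<turnstile> {#B#}"
    using \<Gamma>(2) \<Theta>(2) derivable_in_language[OF \<Gamma>(2)] derivable_in_language[OF \<Theta>(2)]
    by (intro derives.step[OF stl_rule.cut]) auto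
  then show "T \<tturnstile> B"
    by (rule provesI) (use \<Gamma>(1) \<Theta>(1) in auto)
next
  fix T A assume "T \<tturnstile> A"
  then show "\<exists>F. finite F \<and> F \<subseteq> T \<and> F \<tturnstile> A"
    unfolding proves_def by (meson finite_set_mset order_refl)
qed

lemma derivable_of_mem: "A \<in># \<Gamma> \<Longrightarrow> set_mset \<Gamma> \<subseteq> L \<Longrightarrow> \<Gamma> \<turnstile> {#A#}"
  using assumption proves_set_mset_iff by blast

lemma proves_unary_rule:
  assumes "T \<tturnstile> A" "\<And>\<Gamma>. \<Gamma> \<turnstile> {#A#} \<Longrightarrow> set_mset \<Gamma> \<subseteq> L \<Longrightarrow> A \<in> L \<Longrightarrow> \<Gamma> \<turnstile> {#B#}"
  shows "T \<tturnstile> B"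
proof -
  obtain \<Gamma> where \<Gamma>: "set_mset \<Gamma> \<subseteq> T" "\<Gamma> \<turnstile> {#A#}"
    using assms(1) by (auto simp: proves_def)
  then have "\<Gamma> \<turnstile> {#B#}"
    using assms(2) derivable_in_language[OF \<Gamma>(2)] by simp
  then show ?thesis
    using \<Gamma>(1) by (rule provesI)
qed

lemma proves_discharging_rule:
  assumes "insert A T \<tturnstile> B" "A \<in> L"
    and "\<And>\<Gamma>. \<Gamma> + {#A#} \<turnstile> {#B#} \<Longrightarrow> set_mset \<Gamma> \<subseteq> L \<Longrightarrow> B \<in> L \<Longrightarrow> \<Gamma> \<turnstile> {#C#}"
  shows "T \<tturnstile> C"
proof -
  obtain \<Gamma> where \<Gamma>: "set_mset \<Gamma> \<subseteq> T" "\<Gamma> + {#A#} \<turnstile> {#B#}"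
    using proves_insertE[OF assms(1,2)] .
  then have "\<Gamma> \<turnstile> {#C#}"
    using assms(3) derivable_in_language[OF \<Gamma>(2)] by simp
  then show ?thesis
    using \<Gamma>(1) by (rule provesI)
qed

lemma proves_Top: "T \<tturnstile> \<^bold>\<top>"
  by (rule provesI[OF derives.step[OF stl_rule.top_right]]) auto

lemma proves_if_proves_Bot:
  assumes "T \<tturnstile> \<^bold>\<bottom>" "A \<in> L"
  shows "T \<tturnstile> A"
  using assms(1)
proof (rule proves_unary_rule)
  fix \<Gamma> assume "\<Gamma> \<turnstile> {#\<^bold>\<bottom>#}" and L: "set_mset \<Gamma> \<subseteq> L"
  then have "\<Gamma> \<turnstile> {#}"
    by (simp add: proves_set_mset_iff flip: proves_set_mset_Bot_iff)
  then show "\<Gamma> \<turnstile> {#A#}"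
    using L assms(2) by (intro derives.step[OF stl_rule.weak_right]) auto
qed

lemma proves_And_iff:
  assumes "A \<in> L" "B \<in> L"
  shows "T \<tturnstile> A \<^bold>\<and> B \<longleftrightarrow> T \<tturnstile> A \<and> T \<tturnstile> B"
proof (intro iffI conjI)
  assume AB: "T \<tturnstile> A \<^bold>\<and> B"
  have "{#} + {#A \<^bold>\<and> B#} \<turnstile> {#A#}"
    using assms derivable_of_mem by (intro derives.step[OF stl_rule.and_left1]) auto
  then show "T \<tturnstile> A"
    by (intro cut_single[OF AB] provesI) auto
  have "{#} + {#A \<^bold>\<and> B#} \<turnstile> {#B#}"
    using assms derivable_of_mem by (intro derives.step[OF stl_rule.and_left2]) auto
  then show "T \<tturnstile> B"
    by (intro cut_single[OF AB] provesI) auto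
next
  assume "T \<tturnstile> A \<and> T \<tturnstile> B"
  moreover have "{#A, B#} \<turnstile> {#A \<^bold>\<and> B#}"
    using assms derivable_of_mem by (intro derives.step[OF stl_rule.and_right]) auto
  then have "{A, B} \<tturnstile> A \<^bold>\<and> B"
    by (rule provesI) simp
  ultimately show "T \<tturnstile> A \<^bold>\<and> B"
    using cut_pair by blast
qed

lemma proves_OrI1:
  assumes "T \<tturnstile> A" "B \<in> L"
  shows "T \<tturnstile> A \<^bold>\<or> B"
  using assms(1)
  by (rule proves_unary_rule) (use assms(2) in \<open>auto intro: derives.step[OF stl_rule.or_right1]\<close>)

lemma proves_OrI2:
  assumes "T \<tturnstile> B" "A \<in> L"
  shows "T \<tturnstile> A \<^bold>\<or> B"
  using assms(1)
  by (rule proves_unary_rule) (use assms(2) in \<open>auto intro: derives.step[OF stl_rule.or_right2]\<close>)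

lemma Or_proves:
  assumes "A \<in> L" "B \<in> L" "{A} \<tturnstile> C" "{B} \<tturnstile> C"
  shows "{A \<^bold>\<or> B} \<tturnstile> C"
proof -
  have "{#A#} \<turnstile> {#C#}" "{#B#} \<turnstile> {#C#}"
    using assms by (simp_all flip: proves_set_mset_iff)
  then have "{#A \<^bold>\<or> B#} \<turnstile> {#C#}"
    using assms consequence_in_language by (intro derives.step[OF stl_rule.or_left]) auto
  then show ?thesis
    by (rule provesI) simp
qed

lemma proves_nabla_imp_mp:
  assumes "A \<in> L" "B \<in> L"
  shows "{A, \<^bold>\<nabla> (A \<^bold>\<rightarrow> B)} \<tturnstile> B"
proof -
  have "{#A#} + {#\<^bold>\<nabla> (A \<^bold>\<rightarrow> B)#} \<turnstile> {#B#}"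
    using assms derivable_of_mem by (intro derives.step[OF stl_rule.imp_left]) auto
  then show ?thesis
    by (rule provesI) simp
qed

lemma proves_nabla:
  assumes "N \<in> R" "T \<tturnstile> A"
  shows "Nabla ` T \<tturnstile> \<^bold>\<nabla> A"
proof -
  obtain \<Gamma> where \<Gamma>: "set_mset \<Gamma> \<subseteq> T" "\<Gamma> \<turnstile> {#A#}"
    using assms(2) by (auto simp: proves_def)
  then have "Nablas \<Gamma> \<turnstile> Nablas {#A#}"
    using assms(1) derivable_in_language[OF \<Gamma>(2)]
    by (intro derives.step[OF stl_rule.rule_N]) auto
  then show ?thesis
    by (intro provesI[of "Nablas \<Gamma>"]) (use \<Gamma>(1) in auto)
qed

lemma nabla_Bot_proves_Bot:
  assumes "N \<in> R"
  shows "{\<^bold>\<nabla> \<^bold>\<bottom>} \<tturnstile> \<^bold>\<bottom>"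
proof -
  have "{#\<^bold>\<bottom>#} \<turnstile> {#}"
    by (rule derives.step[OF stl_rule.bot_left]) auto
  then have "Nablas {#\<^bold>\<bottom>#} \<turnstile> Nablas {#}"
    using assms by (intro derives.step[OF stl_rule.rule_N]) auto
  then show ?thesis
    using proves_set_mset_Bot_iff[of "{#\<^bold>\<nabla> \<^bold>\<bottom>#}"] by simp
qed

lemma proves_imp_iff:
  assumes "N \<in> R" "A \<in> L"
  shows "T \<tturnstile> A \<^bold>\<rightarrow> B \<longleftrightarrow> insert A (Nabla ` T) \<tturnstile> B"
proof
  assume imp: "T \<tturnstile> A \<^bold>\<rightarrow> B"
  have "insert A (Nabla ` T) \<tturnstile> \<^bold>\<nabla> (A \<^bold>\<rightarrow> B)"
    using proves_nabla[OF assms(1) imp] monotone by blast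
  moreover have "{A, \<^bold>\<nabla> (A \<^bold>\<rightarrow> B)} \<tturnstile> B"
    using consequence_in_language[OF imp] by (intro proves_nabla_imp_mp) auto
  ultimately show "insert A (Nabla ` T) \<tturnstile> B"
    using assumption[OF insertI1 assms(2)] cut_pair by blast
next
  assume "insert A (Nabla ` T) \<tturnstile> B"
  then obtain \<Gamma> where \<Gamma>: "set_mset \<Gamma> \<subseteq> Nabla ` T" "\<Gamma> + {#A#} \<turnstile> {#B#}"
    using assms(2) proves_insertE by blast
  obtain \<Theta> where \<Theta>: "set_mset \<Theta> \<subseteq> T" "\<Gamma> = Nablas \<Theta>"
    using image_mset_of_subset_image[OF \<Gamma>(1)] .
  have "\<Theta> \<turnstile> {#A \<^bold>\<rightarrow> B#}"
    using \<Gamma>(2) \<Theta>(2) derivable_in_language[OF \<Gamma>(2)]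
    by (intro derives.step[OF stl_rule.imp_right]) (auto simp: image_subset_iff)
  then show "T \<tturnstile> A \<^bold>\<rightarrow> B"
    using \<Theta>(1) by (rule provesI)
qed

lemma nabla_proves_iff:
  assumes "N \<in> R"
  shows "{\<^bold>\<nabla> A} \<tturnstile> B \<longleftrightarrow> {A} \<tturnstile> \<^bold>\<top> \<^bold>\<rightarrow> B"
proof -
  have "{\<^bold>\<nabla> A} \<tturnstile> B \<longleftrightarrow> insert \<^bold>\<top> {\<^bold>\<nabla> A} \<tturnstile> B"
    using cut[OF proves_Top] monotone[OF _ subset_insertI] by blast
  then show ?thesis
    using assms by (simp add: proves_imp_iff)
qed

lemma proves_himp_iff:
  assumes "H \<in> R" "A \<in> L"
  shows "T \<tturnstile> A \<^bold>\<supset> B \<longleftrightarrow> insert A T \<tturnstile> B"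
proof
  assume imp: "T \<tturnstile> A \<^bold>\<supset> B"
  have "{#A#} + {#A \<^bold>\<supset> B#} \<turnstile> {#B#}"
    using consequence_in_language[OF imp] derivable_of_mem
    by (intro derives.step[OF stl_rule.rule_H_left]) auto
  then have "{A, A \<^bold>\<supset> B} \<tturnstile> B"
    by (rule provesI) simp
  moreover have "insert A T \<tturnstile> A \<^bold>\<supset> B"
    by (rule monotone[OF imp]) blast
  ultimately show "insert A T \<tturnstile> B"
    using assumption[OF insertI1 assms(2)] cut_pair by blast
next
  assume "insert A T \<tturnstile> B"
  then show "T \<tturnstile> A \<^bold>\<supset> B"
    using assms(2)
    by (rule proves_discharging_rule)
      (use assms in \<open>auto intro: derives.step[OF stl_rule.rule_H_right]\<close>)
qed

lemma proves_nabla_impI: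
  assumes "Fa \<in> R" "A \<in> L" "insert A T \<tturnstile> B"
  shows "T \<tturnstile> \<^bold>\<nabla> (A \<^bold>\<rightarrow> B)"
  using assms(3,2)
  by (rule proves_discharging_rule) (use assms in \<open>auto intro: derives.step[OF stl_rule.rule_Fa]\<close>)

text \<open>Rule (Fu), applied to the provable formula \<open>\<top> \<rightarrow> \<top>\<close>.\<close>

lemma proves_if_nabla_proves:
  assumes "N \<in> R" "Fu \<in> R" "Nabla ` T \<tturnstile> \<^bold>\<nabla> A"
  shows "T \<tturnstile> A"
proof -
  obtain \<Gamma> where \<Gamma>: "set_mset \<Gamma> \<subseteq> Nabla ` T" "\<Gamma> \<turnstile> {#\<^bold>\<nabla> A#}"
    using assms(3) by (auto simp: proves_def)
  obtain \<Theta> where \<Theta>: "set_mset \<Theta> \<subseteq> T" "\<Gamma> = Nablas \<Theta>"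
    using image_mset_of_subset_image[OF \<Gamma>(1)] .
  have L: "set_mset \<Theta> \<subseteq> L" "A \<in> L"
    using derivable_in_language[OF \<Gamma>(2)] \<Theta>(2) by (auto simp: image_subset_iff)
  have "Nablas \<Theta> \<turnstile> {#\<^bold>\<top>#}"
    using L by (subst proves_set_mset_iff[symmetric]) (auto simp: proves_Top)
  moreover have "Nablas \<Theta> + {#\<^bold>\<top>#} \<turnstile> Nablas {#A#}"
    using derivable_weaken[OF \<Gamma>(2), of "{#\<^bold>\<top>#}"] \<Theta>(2) by simp
  ultimately have "\<Theta> + {#\<^bold>\<top> \<^bold>\<rightarrow> \<^bold>\<top>#} \<turnstile> {#A#}"
    using L assms(2) by (intro derives.step[OF stl_rule.rule_Fu]) auto
  then have "insert (\<^bold>\<top> \<^bold>\<rightarrow> \<^bold>\<top>) T \<tturnstile> A"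
    using \<Theta>(1) by (intro provesI) auto
  moreover have "T \<tturnstile> \<^bold>\<top> \<^bold>\<rightarrow> \<^bold>\<top>"
    using proves_imp_iff[OF assms(1)] proves_Top by simp
  ultimately show ?thesis
    using cut by blast
qed

end

section \<open>The calculi with (N) and one of (D), (H)\<close>

locale spacetime_logic = stl_calculus R \<S> for R and \<S> :: "'p sequent set" +
  assumes N_in_R: "N \<in> R" and D_or_H: "D \<in> R \<or> H \<in> R"
begin

text \<open>With (H), the context is moved to the right of \<open>\<^bold>\<supset>\<close> until the rule for \<open>\<^bold>\<or>\<close> applies.\<close>

lemma finite_context_Or_elim:
  assumes "H \<in> R" "finite F" "F \<subseteq> L" "A \<in> L" "B \<in> L" "insert A F \<tturnstile> E" "insert B F \<tturnstile> E"
  shows "insert (A \<^bold>\<or> B) F \<tturnstile> E"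
  using assms(2,3,6,7)
proof (induction F arbitrary: E)
  case empty
  then show ?case using Or_proves assms(4,5) by blast
next
  case (insert G F)
  then have "insert A F \<tturnstile> G \<^bold>\<supset> E" "insert B F \<tturnstile> G \<^bold>\<supset> E"
    using assms(1) by (simp_all add: proves_himp_iff insert_commute)
  then have "insert (A \<^bold>\<or> B) F \<tturnstile> G \<^bold>\<supset> E"
    using insert by blast
  then show ?case
    using assms(1) insert.prems by (simp add: proves_himp_iff insert_commute)
qed

lemma Or_elim:
  assumes L: "A \<in> L" "B \<in> L" and "insert A T \<tturnstile> E" "insert B T \<tturnstile> E"
  shows "insert (A \<^bold>\<or> B) T \<tturnstile> E"
proof -
  obtain \<Gamma> where \<Gamma>: "set_mset \<Gamma> \<subseteq> T" "\<Gamma> + {#A#} \<turnstile> {#E#}"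
    using proves_insertE L(1) assms(3) by blast
  obtain \<Theta> where \<Theta>: "set_mset \<Theta> \<subseteq> T" "\<Theta> + {#B#} \<turnstile> {#E#}"
    using proves_insertE L(2) assms(4) by blast
  have ctx: "set_mset (\<Gamma> + \<Theta>) \<subseteq> L" "E \<in> L"
    using derivable_in_language[OF \<Gamma>(2)] derivable_in_language[OF \<Theta>(2)] by auto
  have from_A: "\<Gamma> + \<Theta> + {#A#} \<turnstile> {#E#}"
    by (rule derivable_structural[OF \<Gamma>(2)]) (use ctx L in auto)
  have from_B: "\<Gamma> + \<Theta> + {#B#} \<turnstile> {#E#}"
    by (rule derivable_structural[OF \<Theta>(2)]) (use ctx L in auto)
  have "insert (A \<^bold>\<or> B) (set_mset (\<Gamma> + \<Theta>)) \<tturnstile> E"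
  proof (cases "H \<in> R")
    case True
    have "insert A (set_mset (\<Gamma> + \<Theta>)) \<tturnstile> E"
      by (rule provesI[OF from_A]) simp
    moreover have "insert B (set_mset (\<Gamma> + \<Theta>)) \<tturnstile> E"
      by (rule provesI[OF from_B]) simp
    ultimately show ?thesis
      by (rule finite_context_Or_elim[OF True finite_set_mset ctx(1) L])
  next
    case False
    then have "\<Gamma> + \<Theta> + {#A \<^bold>\<or> B#} \<turnstile> {#E#}"
      using D_or_H ctx L from_A from_B by (intro derives.step[OF stl_rule.rule_D]) auto
    then show ?thesis
      by (rule provesI) simp
  qed
  then show ?thesis
    by (rule monotone) (use \<Gamma>(1) \<Theta>(1) in auto)
qed

sublocale disjunctive_consequence L proves Or
  by unfold_locales (use proves_OrI1 proves_OrI2 Or_elim in auto)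

lemma nabla_Or_proves:
  assumes "A \<in> L" "B \<in> L"
  shows "{\<^bold>\<nabla> (A \<^bold>\<or> B)} \<tturnstile> \<^bold>\<nabla> A \<^bold>\<or> \<^bold>\<nabla> B"
proof -
  have "{\<^bold>\<nabla> A} \<tturnstile> \<^bold>\<nabla> A \<^bold>\<or> \<^bold>\<nabla> B" "{\<^bold>\<nabla> B} \<tturnstile> \<^bold>\<nabla> A \<^bold>\<or> \<^bold>\<nabla> B"
    using assms by (simp_all add: disj_intro1 disj_intro2 assumption)
  then show ?thesis
    using assms Or_proves by (simp add: nabla_proves_iff[OF N_in_R])
qed

section \<open>The canonical system\<close>

lemma Bot_notin_prime_theory:
  assumes "prime_theory P"
  shows "\<^bold>\<bottom> \<notin> P"
proof
  assume "\<^bold>\<bottom> \<in> P"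
  then have "A \<in> P" if "A \<in> L" for A
    using proves_if_proves_Bot[OF _ that, of P] prime_theory_consequence_iff[OF assms] by blast
  then show False
    using assms by (auto simp: prime_theory_def)
qed

lemma prime_theory_And_iff:
  assumes "prime_theory P" "A \<in> L" "B \<in> L"
  shows "A \<^bold>\<and> B \<in> P \<longleftrightarrow> A \<in> P \<and> B \<in> P"
  using proves_And_iff[OF assms(2,3), of P]
  by (simp add: prime_theory_consequence_iff[OF assms(1)])

lemma prime_theory_himp_iff:
  assumes "H \<in> R" "prime_theory P" "A \<in> L" "B \<in> L"
  shows "A \<^bold>\<supset> B \<in> P \<longleftrightarrow> (\<forall>Q. prime_theory Q \<longrightarrow> P \<subseteq> Q \<longrightarrow> A \<in> Q \<longrightarrow> B \<in> Q)"
proof -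
  have "A \<^bold>\<supset> B \<in> P \<longleftrightarrow> insert A P \<tturnstile> B"
    using assms by (simp add: proves_himp_iff flip: prime_theory_consequence_iff)
  also have "\<dots> \<longleftrightarrow> (\<forall>Q. prime_theory Q \<longrightarrow> insert A P \<subseteq> Q \<longrightarrow> B \<in> Q)"
    using assms prime_theory_subset[OF assms(2)] by (intro consequence_iff_prime_theories) auto
  finally show ?thesis
    by auto
qed

lemma prime_theory_imp_iff:
  assumes "prime_theory P" "A \<in> L" "B \<in> L"
  shows "A \<^bold>\<rightarrow> B \<in> P \<longleftrightarrow> (\<forall>Q. prime_theory Q \<longrightarrow> P \<subseteq> Nabla -` Q \<longrightarrow> A \<in> Q \<longrightarrow> B \<in> Q)"
proof -
  have "A \<^bold>\<rightarrow> B \<in> P \<longleftrightarrow> insert A (Nabla ` P) \<tturnstile> B"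
    using assms by (simp add: proves_imp_iff[OF N_in_R] flip: prime_theory_consequence_iff)
  also have "\<dots> \<longleftrightarrow> (\<forall>Q. prime_theory Q \<longrightarrow> insert A (Nabla ` P) \<subseteq> Q \<longrightarrow> B \<in> Q)"
    using assms prime_theory_subset[OF assms(1)] by (intro consequence_iff_prime_theories) auto
  finally show ?thesis
    by (auto simp: image_subset_iff_subset_vimage)
qed

lemma prime_theory_vimage_Nabla:
  assumes P: "prime_theory P"
  shows "prime_theory (Nabla -` P)"
  unfolding prime_theory_def
proof (intro conjI allI impI)
  have "Nabla -` P \<subseteq> L"
    using prime_theory_subset[OF P] by auto
  moreover have "\<^bold>\<nabla> \<^bold>\<bottom> \<notin> P"
    using prime_theory_closed[OF P _ nabla_Bot_proves_Bot[OF N_in_R]] Bot_notin_prime_theory[OF P]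
    by blast
  ultimately show "Nabla -` P \<subset> L"
    by (auto simp: psubset_eq)
next
  fix A assume "Nabla -` P \<tturnstile> A"
  then have "Nabla ` (Nabla -` P) \<tturnstile> \<^bold>\<nabla> A"
    by (rule proves_nabla[OF N_in_R])
  then show "A \<in> Nabla -` P"
    using prime_theory_closed[OF P image_vimage_subset] by simp
next
  fix A B assume AB: "A \<^bold>\<or> B \<in> Nabla -` P"
  then have L: "A \<in> L" "B \<in> L"
    using prime_theory_subset[OF P] by auto
  have "\<^bold>\<nabla> A \<^bold>\<or> \<^bold>\<nabla> B \<in> P"
    using prime_theory_closed[OF P _ nabla_Or_proves[OF L]] AB by simp
  then show "A \<in> Nabla -` P \<or> B \<in> Nabla -` P"
    using prime_theory_disj_iff[OF P] L by simp
qed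

lemma vimage_Nabla_subset_iff:
  assumes "Fa \<in> R" and P: "prime_theory P" and Q: "prime_theory Q"
  shows "Nabla -` P \<subseteq> Nabla -` Q \<longleftrightarrow> P \<subseteq> Q"
proof
  assume sub: "Nabla -` P \<subseteq> Nabla -` Q"
  show "P \<subseteq> Q"
  proof
    fix A assume A: "A \<in> P"
    then have L: "A \<in> L"
      using prime_theory_subset[OF P] by blast
    have "P \<tturnstile> \<^bold>\<nabla> (\<^bold>\<top> \<^bold>\<rightarrow> A)"
      using A L by (intro proves_nabla_impI[OF assms(1)] assumption) auto
    then have "\<^bold>\<nabla> (\<^bold>\<top> \<^bold>\<rightarrow> A) \<in> Q"
      using prime_theory_consequence_iff[OF P] sub by blast
    moreover have "Q \<tturnstile> \<^bold>\<top>"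
      by (rule proves_Top)
    ultimately show "A \<in> Q"
      using prime_theory_closed[OF Q _ proves_nabla_imp_mp[of "\<^bold>\<top>" A]]
        prime_theory_consequence_iff[OF Q] L by simp
  qed
qed (rule vimage_mono)

lemma directed_nabla_complement:
  assumes P: "prime_theory P"
  shows "directed (Nabla ` (L - P))"
  unfolding directed_def
proof (intro ballI)
  fix E F assume "E \<in> Nabla ` (L - P)" "F \<in> Nabla ` (L - P)"
  then obtain A B where AB: "E = \<^bold>\<nabla> A" "F = \<^bold>\<nabla> B" "A \<in> L" "B \<in> L" "A \<notin> P" "B \<notin> P"
    by blast
  then have "\<^bold>\<nabla> (A \<^bold>\<or> B) \<in> Nabla ` (L - P)"
    using prime_theory_disj_iff[OF P] by simp
  moreover have "{\<^bold>\<nabla> A} \<tturnstile> \<^bold>\<nabla> (A \<^bold>\<or> B)" "{\<^bold>\<nabla> B} \<tturnstile> \<^bold>\<nabla> (A \<^bold>\<or> B)"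
    using AB proves_nabla[OF N_in_R, of "{A}"] proves_nabla[OF N_in_R, of "{B}"]
    by (simp_all add: disj_intro1 disj_intro2 assumption)
  ultimately show "\<exists>G \<in> Nabla ` (L - P). {E} \<tturnstile> G \<and> {F} \<tturnstile> G"
    using AB(1,2) by blast
qed

lemma nabla_avoids_nabla_complement:
  assumes "Fu \<in> R" and P: "prime_theory P"
  shows "avoids (Nabla ` P) (Nabla ` (L - P))"
  unfolding avoids_def
proof (intro ballI notI)
  fix E assume "E \<in> Nabla ` (L - P)" "Nabla ` P \<tturnstile> E"
  then obtain A where "A \<notin> P" "Nabla ` P \<tturnstile> \<^bold>\<nabla> A"
    by blast
  then show False
    using proves_if_nabla_proves[OF N_in_R assms(1)] prime_theory_consequence_iff[OF P] by blast
qed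

lemma vimage_Nabla_surjective:
  assumes "Fu \<in> R" and P: "prime_theory P"
  obtains Q where "prime_theory Q" "Nabla -` Q = P"
proof -
  have "Nabla ` P \<subseteq> L" "Nabla ` (L - P) \<subseteq> L" "Nabla ` (L - P) \<noteq> {}"
    using P by (auto simp: prime_theory_def)
  then obtain Q where Q: "prime_theory Q" "Nabla ` P \<subseteq> Q" "Q \<inter> Nabla ` (L - P) = {}"
    using prime_theory_extension directed_nabla_complement[OF P]
      nabla_avoids_nabla_complement[OF assms] by metis
  have "Nabla -` Q \<subseteq> L"
    using prime_theory_subset[OF Q(1)] by auto
  then have "Nabla -` Q = P"
    using Q(2,3) by blast
  with Q(1) show thesis
    by (rule that)
qed

definition canonical_space :: "'p fm set topology" where
  "canonical_space = upset_topology {P. prime_theory P}"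

lemma topspace_canonical_space [simp]: "topspace canonical_space = {P. prime_theory P}"
  by (simp add: canonical_space_def)

definition canonical_val :: "'p fm \<Rightarrow> 'p fm set set" where
  "canonical_val =
     extend_valuation canonical_space (vimage Nabla) (\<lambda>p. {P. prime_theory P \<and> Atom p \<in> P})"

lemma continuous_map_vimage_Nabla: "continuous_map canonical_space canonical_space (vimage Nabla)"
  unfolding canonical_space_def
  by (rule continuous_map_upset_topology) (auto intro: mono_onI simp: prime_theory_vimage_Nabla)

sublocale canonical: topological_model canonical_space "vimage Nabla" canonical_val
proof
  have "openin canonical_space {P. prime_theory P \<and> Atom p \<in> P}" for p
    by (auto simp: canonical_space_def openin_upset_topology)
  then show "top_model canonical_space (vimage Nabla) canonical_val"
    unfolding canonical_val_def by (rule top_model_extend_valuation[OF continuous_map_vimage_Nabla])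
qed (rule continuous_map_vimage_Nabla)

lemma dyn_top_system_canonical:
  assumes "C \<inter> {Fa, Fu} \<subseteq> R"
  shows "dyn_top_system C canonical_space (vimage Nabla)"
  unfolding dyn_top_system_def
proof (intro conjI impI continuous_map_vimage_Nabla)
  assume "Fa \<in> C"
  then show "embedding_map canonical_space canonical_space (vimage Nabla)"
    unfolding canonical_space_def using assms vimage_Nabla_subset_iff prime_theory_vimage_Nabla
    by (intro embedding_map_upset_topology) auto
next
  assume "Fu \<in> C"
  then have "\<exists>Q. prime_theory Q \<and> Nabla -` Q = P" if "prime_theory P" for P
    using assms that vimage_Nabla_surjective by blast
  then show "vimage Nabla ` topspace canonical_space = topspace canonical_space"
    using prime_theory_vimage_Nabla by force
qed

lemma mem_canonical_val_iff_principal_subset: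
  assumes "prime_theory P"
  shows "P \<in> canonical_val A \<longleftrightarrow> {Q. prime_theory Q \<and> P \<subseteq> Q} \<subseteq> canonical_val A"
  using mem_iff_principal_subset[of "{P. prime_theory P}" "canonical_val A" P]
    canonical.openin_val assms by (simp add: canonical_space_def)

lemma openin_canonical_principal: "openin canonical_space {Q. prime_theory Q \<and> P \<subseteq> Q}"
  using openin_upset_topology_principal[of "{P. prime_theory P}" P]
  by (simp add: canonical_space_def)

lemma mem_canonical_val_himp_iff:
  assumes "prime_theory P"
  shows "P \<in> canonical_val (A \<^bold>\<supset> B) \<longleftrightarrow>
    (\<forall>Q. prime_theory Q \<longrightarrow> P \<subseteq> Q \<longrightarrow> Q \<in> canonical_val A \<longrightarrow> Q \<in> canonical_val B)"
  unfolding mem_canonical_val_iff_principal_subset[OF assms, of "A \<^bold>\<supset> B"]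
    canonical.subset_val_himp_iff[OF openin_canonical_principal]
  by auto

lemma mem_canonical_val_imp_iff:
  assumes "prime_theory P"
  shows "P \<in> canonical_val (A \<^bold>\<rightarrow> B) \<longleftrightarrow>
    (\<forall>Q. prime_theory Q \<longrightarrow> P \<subseteq> Nabla -` Q \<longrightarrow> Q \<in> canonical_val A \<longrightarrow> Q \<in> canonical_val B)"
  unfolding mem_canonical_val_iff_principal_subset[OF assms, of "A \<^bold>\<rightarrow> B"]
    canonical.subset_val_imp_iff[OF openin_canonical_principal] preimage_def
  using prime_theory_vimage_Nabla by auto

lemma mem_canonical_val_iff:
  assumes "A \<in> L" "prime_theory P"
  shows "P \<in> canonical_val A \<longleftrightarrow> A \<in> P"
  using assms
proof (induction A arbitrary: P)
  case (Atom p)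
  then show ?case by (simp add: canonical_val_def)
next
  case Top
  then show ?case using proves_Top prime_theory_consequence_iff by auto
next
  case Bot
  then show ?case by (simp add: Bot_notin_prime_theory)
next
  case (And A B)
  then show ?case by (simp add: prime_theory_And_iff)
next
  case (Or A B)
  then show ?case by (simp add: prime_theory_disj_iff)
next
  case (Imp A B)
  then show ?case by (simp add: mem_canonical_val_imp_iff prime_theory_imp_iff)
next
  case (Nabla A)
  then show ?case by (simp add: preimage_def prime_theory_vimage_Nabla)
next
  case (HImp A B)
  then show ?case by (simp add: mem_canonical_val_himp_iff prime_theory_himp_iff)
qed

lemma canonical_antecedent_val:
  assumes "set_mset \<Gamma> \<subseteq> L"
  shows "canonical.antecedent_val \<Gamma> = {P. prime_theory P \<and> set_mset \<Gamma> \<subseteq> P}"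
  using assms mem_canonical_val_iff by (auto simp: canonical.antecedent_val_def)

theorem canonical_validates_iff_derives:
  assumes "S \<in> sequents R"
  shows "validates canonical_space canonical_val S \<longleftrightarrow> derives R \<S> S"
proof -
  have subset_iff_proves: "canonical.antecedent_val \<Gamma> \<subseteq> canonical_val A \<longleftrightarrow> set_mset \<Gamma> \<tturnstile> A"
    if "set_mset \<Gamma> \<subseteq> L" "A \<in> L" for \<Gamma> A
    using that mem_canonical_val_iff
    by (auto simp: canonical_antecedent_val consequence_iff_prime_theories)
  obtain \<Gamma> \<Delta> where S: "S = (\<Gamma> \<Rrightarrow> \<Delta>)" "set_mset \<Gamma> \<subseteq> L" "set_mset \<Delta> \<subseteq> L" "size \<Delta> \<le> 1"
    using assms by (cases S) auto
  then consider (empty) "\<Delta> = {#}" | (single) A where "\<Delta> = {#A#}"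
    by (cases \<Delta>) auto
  then show ?thesis
  proof cases
    case empty
    then show ?thesis
      using subset_iff_proves[of \<Gamma> "\<^bold>\<bottom>"] S
      by (simp add: canonical.validates_iff proves_set_mset_Bot_iff)
  next
    case (single A)
    then show ?thesis
      using subset_iff_proves[of \<Gamma> A] S by (simp add: canonical.validates_iff proves_set_mset_iff)
  qed
qed

theorem completeness:
  assumes "entails TYPE('p fm set) C \<S> S" "C \<inter> {Fa, Fu} \<subseteq> R"
    and "\<S> \<subseteq> sequents R" "S \<in> sequents R"
  shows "derives R \<S> S"
proof -
  have "\<forall>S' \<in> \<S>. validates canonical_space canonical_val S'"
    using assms(3) canonical_validates_iff_derives derives.hyp by blast
  then have "validates canonical_space canonical_val S"
    using assms(1) dyn_top_system_canonical[OF assms(2)] canonical.top_model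
    unfolding entails_def by blast
  then show ?thesis
    using canonical_validates_iff_derives[OF assms(4)] by blast
qed

end

theorem theorem6p14:
  fixes C :: "axiom_name set" and \<S> :: "'p sequent set" and S :: "'p sequent"
  assumes "C \<subseteq> {Fa, Fu}"
  shows "(\<S> \<subseteq> sequents (C \<union> {N, D}) \<and> S \<in> sequents (C \<union> {N, D}) \<longrightarrow>
            (derives (C \<union> {N, D}) \<S> S \<longleftrightarrow> entails TYPE('p fm set) C \<S> S) \<and>
            (derives (C \<union> {N, D}) \<S> S \<longrightarrow> entails TYPE('x) C \<S> S)) \<and>
         (\<S> \<subseteq> sequents (C \<union> {N, H}) \<and> S \<in> sequents (C \<union> {N, H}) \<longrightarrow>
            (derives (C \<union> {N, H}) \<S> S \<longleftrightarrow> entails TYPE('p fm set) C \<S> S) \<and>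
            (derives (C \<union> {N, H}) \<S> S \<longrightarrow> entails TYPE('x) C \<S> S))"
proof -
  interpret with_D: spacetime_logic "C \<union> {N, D}" \<S>
    by unfold_locales auto
  interpret with_H: spacetime_logic "C \<union> {N, H}" \<S>
    by unfold_locales auto
  have R_sub: "(C \<union> {N, D}) \<inter> {Fa, Fu} \<subseteq> C" "(C \<union> {N, H}) \<inter> {Fa, Fu} \<subseteq> C"
    by auto
  show ?thesis
    using with_D.completeness with_H.completeness
    by (intro conjI impI iffI soundness[OF _ R_sub(1)] soundness[OF _ R_sub(2)]) auto
qed

end
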